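(* Up to isomorphism, there are continuum many finitely generated groups which are not epiRE.
   Context: For a set $X$, $X^*$ denotes the set of all finite strings over $X$, including the empty string. For a group $G$ and $X\subseteq G$, and $w\in X^*$, $g\in G$, write $w=_G g$ if the product in $G$ of the letters of $w$ equals $g$. A group $G$ is epiRE if there are a finite set $X\subseteq G$ generating $G$ as a monoid and a recursively enumerable language $L\subseteq X^*$ such that no $w\in L$ satisfies $w=_G 1_G$, and for every $h\in G\setminus\{1_G\}$ there is $w_h\in L$ with $w_h=_G h$. *)

theory Defs
  imports "HOL-Algebra.Generated_Groups" "HOL-Algebra.Weak_Morphisms" "HOL-Library.Equipollence"
    "HOL-Library.Countable_Set" "HOL-Library.Nat_Bijection" "HOL.Real"
begin

text \<open>Programs for the general recursive functions of Kleene (zero, successor, projections,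
  composition, primitive recursion, minimisation). Arities are not part of the syntax:
  \<open>Zero\<close> is the zero function of every arity, \<open>Proj i\<close> the \<open>i\<close>-th projection (counted from 0) of
  every arity above \<open>i\<close>.\<close>

datatype recf = Zero | Succ | Proj nat | Comp recf "recf list" | Primrec recf recf | Mu recf

inductive recf_eval :: "recf \<Rightarrow> nat list \<Rightarrow> nat \<Rightarrow> bool" where
  zero: "recf_eval Zero xs 0"
| succ: "recf_eval Succ [x] (Suc x)"
| proj: "i < length xs \<Longrightarrow> recf_eval (Proj i) xs (xs ! i)"
| comp: "list_all2 (\<lambda>g y. recf_eval g xs y) gs ys \<Longrightarrow> recf_eval f ys z
    \<Longrightarrow> recf_eval (Comp f gs) xs z"
| primrec_0: "recf_eval f xs y \<Longrightarrow> recf_eval (Primrec f g) (0 # xs) y"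
| primrec_Suc: "recf_eval (Primrec f g) (n # xs) r \<Longrightarrow> recf_eval g (n # r # xs) y
    \<Longrightarrow> recf_eval (Primrec f g) (Suc n # xs) y"
| mu: "recf_eval f (n # xs) 0 \<Longrightarrow> \<forall>m<n. \<exists>k. recf_eval f (m # xs) (Suc k)
    \<Longrightarrow> recf_eval (Mu f) xs n"

text \<open>The recursively enumerable sets are the domains of the partial recursive functions.\<close>

definition re_set :: "nat set \<Rightarrow> bool" where
  "re_set A \<longleftrightarrow> (\<exists>f. A = {n. \<exists>y. recf_eval f [n] y})"

text \<open>Strings over the finite alphabet \<open>X\<close> are coded by numbers: letters through an injective
  numbering \<open>e\<close>, lists of numbers through the computable bijection \<^const>\<open>list_encode\<close>. Since \<open>X\<close>
  is finite, two numberings differ by a finite, hence computable, relabelling of the letters, so the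
  choice of \<open>e\<close> does not matter.\<close>

definition re_language :: "'a set \<Rightarrow> 'a list set \<Rightarrow> bool" where
  "re_language X L \<longleftrightarrow> finite X \<and> L \<subseteq> lists X \<and>
     (\<exists>e::'a \<Rightarrow> nat. inj_on e X \<and> re_set ((\<lambda>w. list_encode (map e w)) ` L))"

definition word_prod :: "('a, 'b) monoid_scheme \<Rightarrow> 'a list \<Rightarrow> 'a" where
  "word_prod G w = foldr (mult G) w \<one>\<^bsub>G\<^esub>"

definition generates_as_monoid :: "('a, 'b) monoid_scheme \<Rightarrow> 'a set \<Rightarrow> bool" where
  "generates_as_monoid G X \<longleftrightarrow> X \<subseteq> carrier G \<and> word_prod G ` lists X = carrier G"

definition epiRE :: "('a, 'b) monoid_scheme \<Rightarrow> bool" where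
  "epiRE G \<longleftrightarrow> group G \<and>
     (\<exists>X L. finite X \<and> generates_as_monoid G X \<and> re_language X L \<and>
        (\<forall>w\<in>L. word_prod G w \<noteq> \<one>\<^bsub>G\<^esub>) \<and>
        (\<forall>h\<in>carrier G - {\<one>\<^bsub>G\<^esub>}. \<exists>w\<in>L. word_prod G w = h))"

definition finitely_generated_group :: "('a, 'b) monoid_scheme \<Rightarrow> bool" where
  "finitely_generated_group G \<longleftrightarrow> group G \<and>
     (\<exists>X. finite X \<and> X \<subseteq> carrier G \<and> generate G X = carrier G)"

text \<open>The isomorphism relation is restricted to the given collection because an isomorphism of
  bare \<open>monoid\<close> records does not constrain the \<open>one\<close> field.\<close>

definition iso_classes :: "'a monoid set \<Rightarrow> 'a monoid set set" where
  "iso_classes \<G> = \<G> // {(G, H). G \<in> \<G> \<and> H \<in> \<G> \<and> G \<cong> H}"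

lemma equiv_iso:
  assumes "\<And>G. G \<in> \<G> \<Longrightarrow> group G"
  shows "equiv \<G> {(G, H). G \<in> \<G> \<and> H \<in> \<G> \<and> G \<cong> H}"
  using assms by (intro equivI refl_onI symI transI) (auto intro: group.iso_sym iso_trans)

text \<open>Finitely generated groups are countable, so up to isomorphism all of them, over whatever
  type, occur with a carrier consisting of natural numbers; and being epiRE is invariant under
  isomorphism.\<close>

lemma countable_finitely_generated_group:
  assumes "finitely_generated_group G"
  shows "countable (carrier G)"
proof -
  obtain X where X: "finite X" "X \<subseteq> carrier G" "generate G X = carrier G" and G: "group G"
    using assms unfolding finitely_generated_group_def by blast
  interpret group G by (fact G)
  let ?Y = "X \<union> (\<lambda>x. inv\<^bsub>G\<^esub> x) ` X"
  have Y: "?Y \<subseteq> carrier G" using X by auto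
  have closed: "word_prod G w \<in> carrier G" if "w \<in> lists ?Y" for w
    using that Y by (induction w) (auto simp: word_prod_def)
  have append: "word_prod G (u @ v) = word_prod G u \<otimes>\<^bsub>G\<^esub> word_prod G v"
    if "u \<in> lists ?Y" "v \<in> lists ?Y" for u v
    using that(1)
  proof (induction u)
    case Nil
    then show ?case using closed[OF that(2)] by (simp add: word_prod_def)
  next
    case (Cons a u)
    then show ?case using closed[OF that(2)] closed[of u] Y
      by (auto simp: word_prod_def m_assoc subset_iff)
  qed
  have "g \<in> word_prod G ` lists ?Y" if "g \<in> generate G X" for g
    using that
  proof (induction rule: generate.induct)
    case one
    have "\<one>\<^bsub>G\<^esub> = word_prod G []" by (simp add: word_prod_def)
    then show ?case by blast
  next
    case (incl h)
    then have "h = word_prod G [h]" using X by (auto simp: word_prod_def)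
    then show ?case using incl by (intro image_eqI[of _ _ "[h]"]) auto
  next
    case (inv h)
    then have "inv\<^bsub>G\<^esub> h = word_prod G [inv\<^bsub>G\<^esub> h]" using X by (auto simp: word_prod_def)
    then show ?case using inv by (intro image_eqI[of _ _ "[inv\<^bsub>G\<^esub> h]"]) auto
  next
    case (eng g h)
    then obtain u v where "u \<in> lists ?Y" "v \<in> lists ?Y" "g = word_prod G u" "h = word_prod G v"
      by blast
    then show ?case using append[of u v] by (metis (no_types, lifting) append_in_lists_conv imageI)
  qed
  then have "carrier G \<subseteq> word_prod G ` lists ?Y" using X by auto
  moreover have "countable (lists ?Y)" using X by (intro countable_lists countable_finite) auto
  ultimately show ?thesis by (meson countable_image countable_subset)
qed

lemma finitely_generated_group_on_nat:
  assumes "finitely_generated_group G"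
  shows "\<exists>H :: nat monoid. group H \<and> G \<cong> H"
proof -
  have G: "group G" using assms unfolding finitely_generated_group_def by blast
  have inj: "inj_on (to_nat_on (carrier G)) (carrier G)"
    using countable_finitely_generated_group[OF assms] by (rule inj_on_to_nat_on)
  show ?thesis
    using group.inj_imp_image_group_is_group[OF G inj] inj_imp_image_group_iso[OF inj]
    unfolding is_iso_def by blast
qed

lemma finitely_generated_group_iso:
  assumes "finitely_generated_group G" "group H" "G \<cong> H"
  shows "finitely_generated_group H"
proof -
  obtain X where X: "finite X" "X \<subseteq> carrier G" "generate G X = carrier G" and G: "group G"
    using assms unfolding finitely_generated_group_def by blast
  obtain f where f: "f \<in> iso G H" using assms unfolding is_iso_def by blast
  interpret group_hom G H f
    using f G assms by (auto simp: group_hom_def group_hom_axioms_def iso_def)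
  have im: "f ` carrier G = carrier H" using f by (auto simp: iso_def bij_betw_def)
  have "generate H (f ` X) = carrier H"
    using generate_img[OF X(2)] X im by simp
  then show ?thesis
    using X im assms unfolding finitely_generated_group_def by (intro conjI exI[of _ "f ` X"]) auto
qed

lemma epiRE_iso:
  fixes G :: "('a, 'c) monoid_scheme" and H :: "('b, 'd) monoid_scheme"
  assumes "epiRE G" "group H" "G \<cong> H"
  shows "epiRE H"
proof -
  obtain X L e where G: "group G" and X: "finite X" "X \<subseteq> carrier G"
    and gen: "word_prod G ` lists X = carrier G"
    and L: "L \<subseteq> lists X" "\<forall>w\<in>L. word_prod G w \<noteq> \<one>\<^bsub>G\<^esub>"
      "\<forall>h\<in>carrier G - {\<one>\<^bsub>G\<^esub>}. \<exists>w\<in>L. word_prod G w = h"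
    and e: "inj_on e X" "re_set ((\<lambda>w. list_encode (map e w)) ` L)"
    using assms unfolding epiRE_def generates_as_monoid_def re_language_def by blast
  obtain f where f: "f \<in> iso G H" using assms unfolding is_iso_def by blast
  interpret group_hom G H f
    using f G assms by (auto simp: group_hom_def group_hom_axioms_def iso_def)
  have inj: "inj_on f (carrier G)" and im: "f ` carrier G = carrier H"
    using f by (auto simp: iso_def bij_betw_def)
  have closed: "word_prod G w \<in> carrier G" if "w \<in> lists X" for w
    using that gen by blast
  have hom: "word_prod H (map f w) = f (word_prod G w)" if "w \<in> lists X" for w
    using that
  proof (induction w)
    case (Cons a w)
    then show ?case using closed[of w] X by (auto simp: word_prod_def subset_iff)
  qed (simp add: word_prod_def)
  have one_iff: "f g = \<one>\<^bsub>H\<^esub> \<longleftrightarrow> g = \<one>\<^bsub>G\<^esub>" if "g \<in> carrier G" for g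
    using inj that by (metis G.one_closed hom_one inj_onD)
  let ?X = "f ` X" and ?L = "map f ` L" and ?e = "\<lambda>y. e (inv_into X f y)"
  have injX: "inj_on f X" using inj X by (meson inj_on_subset)
  have gen': "word_prod H ` lists ?X = carrier H"
  proof -
    have "word_prod H ` lists ?X = (\<lambda>w. f (word_prod G w)) ` lists X"
      unfolding lists_image image_image using hom by (intro image_cong refl)
    also have "\<dots> = f ` carrier G" unfolding gen[symmetric] image_image ..
    finally show ?thesis using im by simp
  qed
  have sub: "?L \<subseteq> lists ?X" using L(1) by (auto simp: lists_image)
  have inj': "inj_on ?e ?X"
  proof (intro inj_onI)
    fix y z assume "y \<in> ?X" "z \<in> ?X" "?e y = ?e z"
    then show "y = z" using e(1) by (metis inj_onD inv_into_into f_inv_into_f)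
  qed
  have relabel: "map ?e (map f w) = map e w" if "w \<in> L" for w
    using that L(1) injX by (auto simp: subset_iff)
  have "(\<lambda>w. list_encode (map ?e w)) ` ?L = (\<lambda>w. list_encode (map e w)) ` L"
    unfolding image_image by (intro image_cong refl arg_cong[of _ _ list_encode] relabel)
  with e(2) have "re_set ((\<lambda>w. list_encode (map ?e w)) ` ?L)" by (simp only:)
  with inj' have "\<exists>e'::'b \<Rightarrow> nat. inj_on e' ?X \<and> re_set ((\<lambda>w. list_encode (map e' w)) ` ?L)"
    by (intro exI[of _ ?e] conjI)
  then have re: "re_language ?X ?L"
    unfolding re_language_def using X(1) sub by (intro conjI finite_imageI)
  have nontriv: "word_prod H v \<noteq> \<one>\<^bsub>H\<^esub>" if v: "v \<in> ?L" for v
  proof -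
    obtain w where w: "w \<in> L" "v = map f w" using v by blast
    then have "w \<in> lists X" using L(1) by blast
    then show ?thesis using w L(2) hom[of w] closed[of w] one_iff by simp
  qed
  have repr: "\<exists>v\<in>?L. word_prod H v = h" if h: "h \<in> carrier H - {\<one>\<^bsub>H\<^esub>}" for h
  proof -
    obtain g where g: "g \<in> carrier G - {\<one>\<^bsub>G\<^esub>}" "h = f g"
    proof -
      from h im obtain g where "g \<in> carrier G" "h = f g" by blast
      then show ?thesis using h that[of g] one_iff by auto
    qed
    then obtain w where "w \<in> L" "word_prod G w = g" using L(3) by blast
    moreover from this have "w \<in> lists X" using L(1) by blast
    ultimately show ?thesis using g(2) hom[of w] by (intro bexI[of _ "map f w"]) simp_all
  qed
  have gen_H: "generates_as_monoid H ?X"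
    unfolding generates_as_monoid_def using gen' X(2) im by blast
  have "finite ?X" using X(1) by (rule finite_imageI)
  then show ?thesis
    unfolding epiRE_def using assms(2) gen_H re nontriv repr by (metis (no_types, lifting))
qed

end

theory Submission
  imports Defs "HOL-Analysis.Abstract_Topology_2" "HOL-Computational_Algebra.Formal_Laurent_Series"
begin

text \<open>The proof is a counting argument: computability enters only through the fact that there are
  countably many recursively enumerable sets.

  Suppose a finitely generated group \<open>G\<close> has a strictly increasing chain of normal subgroups
  \<open>N r\<close>, one for each real \<open>r\<close>. If the quotient by \<open>N r\<close> is epiRE, lift the letters of the
  witnessing alphabet to \<open>G\<close>; the language together with the lifts is one of countably many data.
  Two members \<open>N r \<subset> N s\<close> of the chain cannot share a datum: an element \<open>h\<close> of \<open>N s\<close> outside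
  \<open>N r\<close> is nontrivial modulo \<open>N r\<close>, so some word of the language has value in \<open>N r h \<subseteq> N s\<close>,
  and that word is trivial modulo \<open>N s\<close>, which is forbidden. Hence all but countably many of the
  quotients fail to be epiRE (\<open>countable_epiRE_in_chain\<close>).

  A homomorphism is determined by its values on a finite generating set, so a fixed countable group
  is isomorphic to the quotient by \<open>N r\<close> for only countably many \<open>r\<close>
  (\<open>countable_normal_with_quotient\<close>). The quotients that are not epiRE therefore fall into
  continuum many isomorphism classes (\<open>lepoll_non_epiRE_if_normal_chain\<close>). More than that cannot
  occur, since there are at most continuum many group structures on sets of natural numbers
  (\<open>nat_monoids_lepoll_reals\<close>).

  Such a chain exists in P. Hall's finitely generated group of upper triangular 3-by-3 matrices whose
  centre contains every power of an indeterminate \<open>x\<close> as a corner entry. Label the exponents by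
  the rational numbers; the corner entries supported on exponents with label below \<open>r\<close> form a
  central subgroup, and it grows strictly with \<open>r\<close> because the rationals are dense
  (\<open>real_chain_in_hall_group\<close>).\<close>

section \<open>Countability\<close>

instance recf :: countable
  by countable_datatype

lemma countable_re_sets: "countable {A. re_set A}"
proof -
  have "{A. re_set A} \<subseteq> range (\<lambda>f. {n. \<exists>y. recf_eval f [n] y})"
    unfolding re_set_def by blast
  then show ?thesis by (rule countable_subset) simp
qed

text \<open>Cardinal form of the pigeonhole principle: covering \<open>A\<close> by \<open>C\<close> and the fibres bounds it by
  \<open>B \<times> \<nat>\<close>, and \<open>B\<close> absorbs the countable factor because it cannot be countable itself.\<close>

lemma lepoll_if_countable_fibres:
  includes cardinal_syntax
  assumes A: "uncountable A" and C: "countable C"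
    and f: "f \<in> A - C \<rightarrow> B" and fibres: "\<And>b. b \<in> B \<Longrightarrow> countable {a \<in> A - C. f a = b}"
  shows "A \<lesssim> B"
proof -
  have cover: "A - C \<subseteq> (\<Union>b\<in>B. {a \<in> A - C. f a = b})" using f by auto
  have "uncountable (A - C)" using A C by (rule uncountable_minus_countable)
  then have "uncountable B"
    using countable_subset[OF cover] fibres by (intro notI) (simp add: countable_UN)
  then have inf: "infinite B" by (rule uncountable_infinite)
  have small: "|D| \<le>o |B|" if "countable D" for D :: "'a set"
  proof -
    have "|D| \<le>o |UNIV :: nat set|"
      using that by (auto simp: countable_def intro!: iffD1[OF card_of_ordLeq])
    then show ?thesis using inf infinite_iff_card_of_nat ordLeq_transitive by blast
  qed
  \<comment> \<open>Adding \<open>C\<close> to every fibre covers all of \<open>A\<close> by one union indexed by \<open>B\<close>.\<close>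
  have "|\<Union>b\<in>B. C \<union> {a \<in> A - C. f a = b}| \<le>o |B|"
    using C fibres by (intro card_of_UNION_ordLeq_infinite inf ballI small) (auto intro: card_of_mono1)
  moreover have "A \<subseteq> (\<Union>b\<in>B. C \<union> {a \<in> A - C. f a = b})"
    using cover inf by fastforce
  ultimately have "|A| \<le>o |B|" using card_of_mono1 ordLeq_transitive by blast
  then show ?thesis by (simp add: lepoll_def card_of_ordLeq)
qed

text \<open>A structure on the natural numbers is recorded by a set of number lists, in which the length
  of an entry tells which field of the record it comes from.\<close>

lemma nat_monoids_lepoll_reals: "(UNIV :: nat monoid set) \<lesssim> (UNIV :: real set)"
proof -
  define code :: "nat monoid \<Rightarrow> nat set" where
    "code G = list_encode ` ({[\<one>\<^bsub>G\<^esub>]} \<union> (\<lambda>x. [x, 0]) ` carrier G \<union> range (\<lambda>(x, y). [x, y, x \<otimes>\<^bsub>G\<^esub> y]))"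
    for G
  have "inj code"
  proof (rule injI)
    fix G H assume "code G = code H"
    then have eq: "{[\<one>\<^bsub>G\<^esub>]} \<union> (\<lambda>x. [x, 0]) ` carrier G \<union> range (\<lambda>(x, y). [x, y, x \<otimes>\<^bsub>G\<^esub> y])
      = {[\<one>\<^bsub>H\<^esub>]} \<union> (\<lambda>x. [x, 0]) ` carrier H \<union> range (\<lambda>(x, y). [x, y, x \<otimes>\<^bsub>H\<^esub> y])"
      unfolding code_def by (simp only: inj_image_eq_iff[OF inj_list_encode])
    show "G = H"
    proof (rule monoid.equality)
      have "x \<in> carrier G \<longleftrightarrow> x \<in> carrier H" for x
        using arg_cong[OF eq, of "\<lambda>S. [x, 0] \<in> S"] by (auto simp: image_iff)
      then show "carrier G = carrier H" by blast
      have "[x, y, x \<otimes>\<^bsub>G\<^esub> y] \<in> range (\<lambda>(x, y). [x, y, x \<otimes>\<^bsub>G\<^esub> y])" for x y by force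
      then have "x \<otimes>\<^bsub>G\<^esub> y = x \<otimes>\<^bsub>H\<^esub> y" for x y
        using arg_cong[OF eq, of "\<lambda>S. [x, y, x \<otimes>\<^bsub>G\<^esub> y] \<in> S"] by (auto simp: image_iff)
      then show "monoid.mult G = monoid.mult H" by blast
      show "one G = one H"
        using arg_cong[OF eq, of "\<lambda>S. [\<one>\<^bsub>G\<^esub>] \<in> S"] by (auto simp: image_iff)
    qed simp
  qed
  then have "(UNIV :: nat monoid set) \<lesssim> (UNIV :: nat set set)"
    unfolding lepoll_def by blast
  then show ?thesis using nat_sets_eqpoll_reals by (rule lepoll_trans2)
qed

section \<open>Quotients of a finitely generated group\<close>

text \<open>What remains of an epiRE witness for the quotient by \<open>N\<close> when its words are evaluated in \<open>G\<close>:
  letter \<open>i\<close> stands for the group element \<open>gs ! i\<close>. The pair \<open>(K, gs)\<close> itself makes no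
  reference to cosets of \<open>N\<close>, so data for different \<open>N\<close> can be compared.\<close>

definition detects_complement ::
    "('a, 'b) monoid_scheme \<Rightarrow> 'a set \<Rightarrow> nat list set \<Rightarrow> 'a list \<Rightarrow> bool" where
  "detects_complement G N K gs \<longleftrightarrow>
     (\<forall>v\<in>K. word_prod G (map ((!) gs) v) \<notin> N) \<and>
     (\<forall>h\<in>carrier G - N. \<exists>v\<in>K. word_prod G (map ((!) gs) v) \<in> N #>\<^bsub>G\<^esub> h)"

text \<open>The heart of the argument. An element of \<open>M\<close> outside \<open>N\<close> must be hit, modulo \<open>N\<close>, by a word
  of \<open>K\<close>; the value of this word then lies in \<open>M\<close>, where words of \<open>K\<close> may not go.\<close>

lemma detects_complement_antichain:
  assumes G: "group G" and M: "subgroup M G" and sub: "N \<subseteq> M"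
    and "detects_complement G N K gs" "detects_complement G M K gs"
  shows "N = M"
proof (rule ccontr)
  assume "N \<noteq> M"
  then obtain h where h: "h \<in> M" "h \<notin> N" using sub by blast
  then have "h \<in> carrier G" using M subgroup.subset by blast
  with h assms obtain v where v: "v \<in> K" "word_prod G (map ((!) gs) v) \<in> N #>\<^bsub>G\<^esub> h"
    unfolding detects_complement_def by blast
  have "N #>\<^bsub>G\<^esub> h \<subseteq> M"
    using sub h(1) M unfolding r_coset_def by (auto intro: subgroup.m_closed)
  then show False using v assms unfolding detects_complement_def by blast
qed

lemma (in normal) word_prod_Mod:
  assumes "\<forall>x\<in>set w. r x \<in> carrier G \<and> H #> r x = x"
  shows "word_prod G (map r w) \<in> carrier G \<and> word_prod (G Mod H) w = H #> word_prod G (map r w)"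
  using assms
proof (induction w)
  case Nil
  then show ?case by (simp add: word_prod_def FactGroup_def coset_mult_one subset)
next
  case (Cons x w)
  then have x: "r x \<in> carrier G" "H #> r x = x" and IH: "word_prod G (map r w) \<in> carrier G"
    "word_prod (G Mod H) w = H #> word_prod G (map r w)" by auto
  have "word_prod (G Mod H) (x # w) = x <#> word_prod (G Mod H) w"
    by (simp add: word_prod_def FactGroup_def)
  also have "\<dots> = H #> (r x \<otimes> word_prod G (map r w))"
    using rcos_sum[OF x(1) IH(1)] x(2) IH(2) by simp
  finally show ?case using x IH by (simp add: word_prod_def)
qed

lemma (in normal) epiRE_Mod_imp_detects_complement:
  assumes "epiRE (G Mod H)"
  shows "\<exists>K gs. re_set (list_encode ` K) \<and> gs \<in> lists (carrier G) \<and> detects_complement G H K gs"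
proof -
  obtain X L where X: "finite X" and gen: "generates_as_monoid (G Mod H) X"
    and re: "re_language X L" and avoid: "\<forall>w\<in>L. word_prod (G Mod H) w \<noteq> \<one>\<^bsub>G Mod H\<^esub>"
    and cover: "\<forall>h\<in>carrier (G Mod H) - {\<one>\<^bsub>G Mod H\<^esub>}. \<exists>w\<in>L. word_prod (G Mod H) w = h"
    using assms unfolding epiRE_def by (elim conjE exE)
  have XG: "X \<subseteq> carrier (G Mod H)" using gen unfolding generates_as_monoid_def by (rule conjunct1)
  obtain e where L: "L \<subseteq> lists X"
    and e: "inj_on e X" "re_set ((\<lambda>w. list_encode (map e w)) ` L)"
    using re unfolding re_language_def by (elim conjE exE)
  have one: "\<one>\<^bsub>G Mod H\<^esub> = H" by (simp add: FactGroup_def)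
  have "\<exists>g. g \<in> carrier G \<and> H #> g = x" if "x \<in> X" for x
  proof -
    have "x \<in> rcosets H" using that XG by (auto simp: FactGroup_def)
    then show ?thesis unfolding RCOSETS_def by blast
  qed
  then obtain r where r: "\<And>x. x \<in> X \<Longrightarrow> r x \<in> carrier G \<and> H #> r x = x" by metis
  have "finite (e ` X)" using X by (rule finite_imageI)
  then obtain n where n: "\<And>x. x \<in> X \<Longrightarrow> e x < n"
    unfolding finite_nat_set_iff_bounded by blast
  \<comment> \<open>The list \<open>gs\<close> is indexed by codes of letters; indices below \<open>n\<close> that code no letter are filled
    with the identity.\<close>
  define g where "g i = (if i \<in> e ` X then r (inv_into X e i) else \<one>)" for i
  define gs where "gs = map g [0..<n]"
  have nth: "gs ! e x = r x" if "x \<in> X" for x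
    using that n[OF that] e(1) by (simp add: gs_def g_def)
  have g: "g i \<in> carrier G" for i
    using r by (auto simp: g_def inv_into_into)
  define K where "K = map e ` L"
  have word: "word_prod G (map ((!) gs) (map e w)) \<in> carrier G \<and>
      word_prod (G Mod H) w = H #> word_prod G (map ((!) gs) (map e w))" if w: "w \<in> L" for w
  proof -
    have wX: "\<forall>x\<in>set w. x \<in> X" using w L by auto
    then have eq: "map ((!) gs) (map e w) = map r w" using nth by simp
    show ?thesis unfolding eq by (rule word_prod_Mod) (use wX r in blast)
  qed
  have "detects_complement G H K gs"
    unfolding detects_complement_def
  proof (intro conjI ballI)
    fix v assume "v \<in> K"
    then obtain w where w: "w \<in> L" "v = map e w" unfolding K_def by blast
    have "H #> word_prod G (map ((!) gs) v) \<noteq> H"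
      using word[OF w(1)] bspec[OF avoid w(1)] unfolding w(2) one by simp
    then show "word_prod G (map ((!) gs) v) \<notin> H"
      using rcos_const[OF is_group] by blast
  next
    fix h assume h: "h \<in> carrier G - H"
    have "H #> h \<in> carrier (G Mod H)" using h by (auto simp: FactGroup_def RCOSETS_def)
    moreover have "H #> h \<noteq> H" using h coset_join1 is_subgroup by blast
    ultimately obtain w where w: "w \<in> L" "word_prod (G Mod H) w = H #> h"
      using cover unfolding one by blast
    have "word_prod G (map ((!) gs) (map e w)) \<in> H #> word_prod G (map ((!) gs) (map e w))"
      using word[OF w(1)] rcos_self[OF _ is_subgroup] by blast
    then have "word_prod G (map ((!) gs) (map e w)) \<in> H #> h"
      using word[OF w(1)] w(2) by (simp only:)
    then show "\<exists>v\<in>K. word_prod G (map ((!) gs) v) \<in> H #> h"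
      using w(1) unfolding K_def by blast
  qed
  moreover have "re_set (list_encode ` K)" using e(2) by (simp add: K_def image_image)
  moreover have "gs \<in> lists (carrier G)" using g by (auto simp: gs_def)
  ultimately show ?thesis by blast
qed

text \<open>Choosing a datum for every epiRE quotient of the chain gives an injection into a countable
  set: comparability of any two members is what lets the antichain lemma separate them.\<close>

lemma countable_epiRE_in_chain:
  fixes N :: "'i::linorder \<Rightarrow> 'a set"
  assumes G: "group G" and ctbl: "countable (carrier G)"
    and normal: "\<And>i. N i \<lhd> G" and chain: "strict_mono N"
  shows "countable {i. epiRE (G Mod N i)}"
proof -
  define C where "C = {K. re_set (list_encode ` K)} \<times> lists (carrier G)"
  have "countable ((`) list_encode ` {K. re_set (list_encode ` K)})"
    by (rule countable_subset[OF _ countable_re_sets]) blast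
  moreover have "inj ((`) list_encode)"
    by (intro injI) (simp add: inj_image_eq_iff[OF inj_list_encode])
  ultimately have "countable {K. re_set (list_encode ` K)}"
    by (metis countable_image_inj_on inj_on_subset subset_UNIV)
  then have C: "countable C" using ctbl unfolding C_def by auto
  have "\<exists>c\<in>C. detects_complement G (N i) (fst c) (snd c)" if "epiRE (G Mod N i)" for i
    using normal.epiRE_Mod_imp_detects_complement[OF normal that] unfolding C_def by force
  then obtain c where c: "\<And>i. epiRE (G Mod N i) \<Longrightarrow>
      c i \<in> C \<and> detects_complement G (N i) (fst (c i)) (snd (c i))" by metis
  have sub: "subgroup (N i) G" for i using normal normal_imp_subgroup by blast
  have neq: "c i \<noteq> c j" if "i < j" "epiRE (G Mod N i)" "epiRE (G Mod N j)" for i j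
    using detects_complement_antichain[OF G sub[of j], of "N i" "fst (c i)" "snd (c i)"]
      c[OF that(2)] c[OF that(3)] strict_monoD[OF chain that(1)] by force
  have "inj_on c {i. epiRE (G Mod N i)}"
  proof (rule inj_onI, rule ccontr)
    fix i j assume "i \<in> {i. epiRE (G Mod N i)}" "j \<in> {i. epiRE (G Mod N i)}" "c i = c j" "i \<noteq> j"
    then show False using neq[of i j] neq[of j i] by (cases "i < j") (auto simp: not_less_iff_gr_or_eq)
  qed
  moreover have "countable (c ` {i. epiRE (G Mod N i)})"
    using c by (intro countable_subset[OF _ C]) auto
  ultimately show ?thesis by (rule countable_image_inj_on[rotated])
qed

text \<open>Such an \<open>N\<close> is the kernel of a homomorphism to \<open>H\<close>, and a homomorphism is determined by
  the tuple of values on a finite generating set, for which there are countably many choices.\<close>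

lemma countable_normal_with_quotient:
  fixes G (structure)
  assumes fg: "finitely_generated_group G" and H: "group H" "countable (carrier H)"
  shows "countable {N. N \<lhd> G \<and> G Mod N \<cong> H}" (is "countable ?\<N>")
proof -
  obtain X where X: "finite X" "X \<subseteq> carrier G" "generate G X = carrier G" and G: "group G"
    using fg unfolding finitely_generated_group_def by blast
  interpret G: group G by (fact G)
  obtain xs where xs: "set xs = X" using X(1) finite_list by blast
  have "\<exists>f. f \<in> hom G H \<and> kernel G H f = N" if "N \<in> ?\<N>" for N
  proof -
    interpret normal N G using that by simp
    have "G Mod N \<cong> H" using that by simp
    then obtain \<phi> where \<phi>: "\<phi> \<in> iso (G Mod N) H" by (auto simp: is_iso_def)
    have Q: "group (G Mod N)" by (rule factorgroup_is_group)
    have \<phi>hom: "\<phi> \<in> hom (G Mod N) H" and inj: "inj_on \<phi> (carrier (G Mod N))"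
      using \<phi> by (auto simp: iso_def bij_betw_def)
    have hom: "\<phi> \<circ> (#>) N \<in> hom G H"
      using r_coset_hom_Mod \<phi>hom by (rule hom_compose)
    have "\<phi> (N #> g) = \<one>\<^bsub>H\<^esub> \<longleftrightarrow> g \<in> N" if g: "g \<in> carrier G" for g
    proof -
      have "\<phi> N = \<one>\<^bsub>H\<^esub>" using hom_one[OF \<phi>hom Q H(1)] by (simp add: FactGroup_def)
      moreover have "N #> g \<in> carrier (G Mod N)" "N \<in> carrier (G Mod N)"
        using g subgroup_in_rcosets[OF G] by (auto simp: FactGroup_def RCOSETS_def)
      ultimately have "\<phi> (N #> g) = \<one>\<^bsub>H\<^esub> \<longleftrightarrow> N #> g = N"
        using inj by (metis inj_onD)
      also have "\<dots> \<longleftrightarrow> g \<in> N"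
        using g G.coset_join1 rcos_const[OF G] is_subgroup by blast
      finally show ?thesis .
    qed
    then have "kernel G H (\<phi> \<circ> (#>) N) = N"
      using subset by (auto simp: kernel_def)
    with hom show ?thesis by blast
  qed
  then obtain f where f: "\<And>N. N \<in> ?\<N> \<Longrightarrow> f N \<in> hom G H \<and> kernel G H (f N) = N" by metis
  have "inj_on (\<lambda>N. map (f N) xs) ?\<N>"
  proof (rule inj_onI)
    fix N M assume N: "N \<in> ?\<N>" and M: "M \<in> ?\<N>" and "map (f N) xs = map (f M) xs"
    then have agree: "f N x = f M x" if "x \<in> X" for x using that xs by auto
    interpret N: group_hom G H "f N"
      using f[OF N] G H by (simp add: group_hom_def group_hom_axioms_def)
    interpret M: group_hom G H "f M"
      using f[OF M] G H by (simp add: group_hom_def group_hom_axioms_def)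
    have "f N g = f M g" if "g \<in> generate G X" for g
      using that
    proof induction
      case (eng g h)
      then have "g \<in> carrier G" "h \<in> carrier G" using X(3) by auto
      then show ?case using eng by simp
    qed (use agree X(2) in \<open>auto simp: subset_iff\<close>)
    then have "kernel G H (f N) = kernel G H (f M)" using X(3) by (auto simp: kernel_def)
    then show "N = M" using f[OF N] f[OF M] by simp
  qed
  moreover have "(\<lambda>N. map (f N) xs) ` ?\<N> \<subseteq> lists (carrier H)"
  proof clarify
    fix N x assume "N \<lhd> G" "G Mod N \<cong> H" "x \<in> set (map (f N) xs)"
    then show "x \<in> carrier H" using f[of N] xs X(2) by (auto simp: hom_def)
  qed
  then have "countable ((\<lambda>N. map (f N) xs) ` ?\<N>)"
    using H(2) countable_lists countable_subset by blast
  ultimately show ?thesis by (rule countable_image_inj_on[rotated])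
qed

lemma finitely_generated_Mod:
  assumes fg: "finitely_generated_group G" and N: "N \<lhd> G"
  shows "finitely_generated_group (G Mod N)"
proof -
  obtain X where X: "finite X" "X \<subseteq> carrier G" "generate G X = carrier G" and G: "group G"
    using fg unfolding finitely_generated_group_def by blast
  interpret normal N G by (fact N)
  interpret \<pi>: group_hom G "G Mod N" "(#>\<^bsub>G\<^esub>) N"
    using r_coset_hom_Mod factorgroup_is_group G by (simp add: group_hom_def group_hom_axioms_def)
  have onto: "(#>\<^bsub>G\<^esub>) N ` carrier G = carrier (G Mod N)"
    by (auto simp: FactGroup_def RCOSETS_def)
  then have "generate (G Mod N) ((#>\<^bsub>G\<^esub>) N ` X) = carrier (G Mod N)"
    using \<pi>.generate_img[OF X(2)] X(3) by simp
  then show ?thesis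
    using X onto factorgroup_is_group unfolding finitely_generated_group_def
    by (intro conjI exI[of _ "(#>\<^bsub>G\<^esub>) N ` X"]) auto
qed

text \<open>Outside the countably many epiRE indices, sending \<open>i\<close> to the isomorphism class of the
  \<open>i\<close>-th quotient has countable fibres, so the classes are at least as numerous as the indices.
  The quotients are first copied to carriers of natural numbers.\<close>

theorem lepoll_non_epiRE_if_normal_chain:
  fixes G :: "('a, 'b) monoid_scheme" and N :: "'i::linorder \<Rightarrow> 'a set"
  assumes fg: "finitely_generated_group G" and uncountable: "uncountable (UNIV :: 'i set)"
    and normal: "\<And>i. N i \<lhd> G" and chain: "strict_mono N"
  shows "(UNIV :: 'i set) \<lesssim>
    iso_classes {G :: nat monoid. finitely_generated_group G \<and> \<not> epiRE G}" (is "_ \<lesssim> iso_classes ?\<G>")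
proof -
  have G: "group G" using fg unfolding finitely_generated_group_def by blast
  define C where "C = {i. epiRE (G Mod N i)}"
  have C: "countable C"
    using countable_epiRE_in_chain[OF G countable_finitely_generated_group[OF fg] normal chain]
    unfolding C_def .
  have fgQ: "finitely_generated_group (G Mod N i)" for i
    using finitely_generated_Mod[OF fg normal] .
  then have "\<exists>H :: nat monoid. group H \<and> G Mod N i \<cong> H" for i
    by (rule finitely_generated_group_on_nat)
  then obtain Q :: "'i \<Rightarrow> nat monoid" where Q: "\<And>i. group (Q i)" "\<And>i. G Mod N i \<cong> Q i" by metis
  have groupQ: "group (G Mod N i)" for i using fgQ unfolding finitely_generated_group_def by blast
  have in\<G>: "Q i \<in> ?\<G>" if "i \<notin> C" for i
    using that finitely_generated_group_iso[OF fgQ Q(1) Q(2), of i]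
      epiRE_iso[of "Q i" "G Mod N i"] groupQ group.iso_sym[OF groupQ Q(2)]
    unfolding C_def by blast
  define R where "R = {(H, K). H \<in> ?\<G> \<and> K \<in> ?\<G> \<and> H \<cong> K}"
  have equiv: "equiv ?\<G> R"
    unfolding R_def by (rule equiv_iso) (simp add: finitely_generated_group_def)
  show ?thesis
  proof (rule lepoll_if_countable_fibres[OF uncountable C])
    show "(\<lambda>i. R `` {Q i}) \<in> UNIV - C \<rightarrow> iso_classes ?\<G>"
      unfolding iso_classes_def R_def[symmetric] using in\<G> by (auto intro: quotientI)
  next
    fix b
    show "countable {i \<in> UNIV - C. R `` {Q i} = b}" (is "countable ?F")
    proof (cases "?F = {}")
      case True
      then show ?thesis by (metis countable_empty)
    next
      case False
      then obtain j where j: "j \<notin> C" "R `` {Q j} = b" by blast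
      have "G Mod N i \<cong> Q j" if "i \<in> ?F" for i
      proof -
        have "(Q i, Q j) \<in> R"
          using that j in\<G> eq_equiv_class_iff[OF equiv, of "Q i" "Q j"] by auto
        then show ?thesis using Q(2) iso_trans unfolding R_def by blast
      qed
      then have "N ` ?F \<subseteq> {M. M \<lhd> G \<and> G Mod M \<cong> Q j}" using normal by blast
      moreover have "countable {M. M \<lhd> G \<and> G Mod M \<cong> Q j}"
        by (rule countable_normal_with_quotient[OF fg Q(1)]) simp
      ultimately have "countable (N ` ?F)" by (rule countable_subset)
      moreover have "inj_on N ?F" by (rule strict_mono_imp_inj_on[OF chain])
      ultimately show ?thesis by (rule countable_image_inj_on)
    qed
  qed
qed

section \<open>Hall's group\<close>

text \<open>The tuple \<open>(u, a, b, c)\<close> is the matrix with rows \<open>(1, a, c)\<close>, \<open>(0, u, b)\<close>, \<open>(0, 0, 1)\<close>, and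
  the operation is the matrix product.\<close>

definition hall_group :: "('k::field \<times> 'k \<times> 'k \<times> 'k) monoid" where
  "hall_group = \<lparr>carrier = {(u, a, b, c). u \<noteq> 0},
     monoid.mult = (\<lambda>(u, a, b, c) (u', a', b', c'). (u * u', a' + a * u', u * b' + b, c' + a * b' + c)),
     one = (1, 0, 0, 0)\<rparr>"

lemma group_hall: "group (hall_group :: ('k::field \<times> 'k \<times> 'k \<times> 'k) monoid)"
proof (rule groupI)
  fix x :: "'k \<times> 'k \<times> 'k \<times> 'k" assume "x \<in> carrier hall_group"
  then obtain u a b c where "x = (u, a, b, c)" "u \<noteq> 0" by (auto simp: hall_group_def)
  then show "\<exists>y\<in>carrier hall_group. y \<otimes>\<^bsub>hall_group\<^esub> x = \<one>\<^bsub>hall_group\<^esub>"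
    by (intro bexI[of _ "(1 / u, - a / u, - b / u, a * b / u - c)"])
      (auto simp: hall_group_def field_simps)
qed (auto simp: hall_group_def algebra_simps)

lemma hall_mult [simp]:
  "(u, a, b, c) \<otimes>\<^bsub>hall_group\<^esub> (u', a', b', c')
    = (u * u', a' + a * u', u * b' + b, c' + a * b' + c)"
  by (simp add: hall_group_def)

lemma hall_one [simp]: "\<one>\<^bsub>hall_group\<^esub> = (1, 0, 0, 0)"
  by (simp add: hall_group_def)

lemma hall_carrier [simp]: "(u, a, b, c) \<in> carrier hall_group \<longleftrightarrow> u \<noteq> 0"
  by (simp add: hall_group_def)

lemma hall_inv:
  assumes "u \<noteq> 0"
  shows "inv\<^bsub>hall_group\<^esub> (u, a, b, c) = (1 / u, - a / u, - b / u, a * b / u - c)"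
  by (rule group.inv_equality[OF group_hall]) (use assms in \<open>auto simp: field_simps\<close>)

text \<open>The diagonal matrix with middle entry \<open>x\<close> and the two elementary matrices next to the
  diagonal.\<close>

definition hall_generators :: "'k::field \<Rightarrow> ('k \<times> 'k \<times> 'k \<times> 'k) set" where
  "hall_generators x = {(x, 0, 0, 0), (1, 1, 0, 0), (1, 0, 1, 0)}"

text \<open>Conjugation by the diagonal generator multiplies the entry \<open>a\<close> by \<open>x\<close>, and the commutator of
  the elementary matrices with entries \<open>a\<close> and \<open>b\<close> has corner entry \<open>a b\<close>. So finitely many
  generators yield every power of \<open>x\<close> as a corner entry.\<close>

lemma central_powers_generated:
  fixes x :: "'k::field"
  assumes x: "x \<noteq> 0"
  shows "(1, 0, 0, x ^ k) \<in> generate hall_group (hall_generators x)" (is "_ \<in> ?\<Gamma>")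
proof -
  interpret group "hall_group :: ('k \<times> 'k \<times> 'k \<times> 'k) monoid" by (rule group_hall)
  have sub: "subgroup ?\<Gamma> hall_group"
    by (rule generate_is_subgroup) (use x in \<open>auto simp: hall_generators_def\<close>)
  have gens: "(x, 0, 0, 0) \<in> ?\<Gamma>" "(1, 1, 0, 0) \<in> ?\<Gamma>" "(1, 0, 1, 0) \<in> ?\<Gamma>"
    by (auto intro: generate.incl simp: hall_generators_def)
  note closed = subgroup.m_closed[OF sub] subgroup.m_inv_closed[OF sub]
  have a: "(1, x ^ k, 0, 0) \<in> ?\<Gamma>"
  proof (induction k)
    case (Suc k)
    have "inv\<^bsub>hall_group\<^esub> (x, 0, 0, 0) \<otimes>\<^bsub>hall_group\<^esub> ((1, x ^ k, 0, 0) \<otimes>\<^bsub>hall_group\<^esub> (x, 0, 0, 0)) \<in> ?\<Gamma>"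
      using Suc gens by (intro closed)
    then show ?case using x by (simp add: hall_inv mult.commute)
  qed (use gens in simp)
  have "(1, x ^ k, 0, 0) \<otimes>\<^bsub>hall_group\<^esub> (1, 0, 1, 0) \<otimes>\<^bsub>hall_group\<^esub>
      inv\<^bsub>hall_group\<^esub> ((1, 0, 1, 0) \<otimes>\<^bsub>hall_group\<^esub> (1, x ^ k, 0, 0)) \<in> ?\<Gamma>"
    using a gens by (intro closed)
  then show ?thesis by (simp add: hall_inv)
qed

text \<open>Corner entries add under multiplication and commute with every matrix, so each additive
  group \<open>D\<close> of corner entries cuts out a central, hence normal, subgroup.\<close>

lemma central_subgroup_normal:
  fixes \<Gamma> :: "('k::field \<times> 'k \<times> 'k \<times> 'k) set"
  assumes \<Gamma>: "subgroup \<Gamma> hall_group"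
    and D: "0 \<in> D" "\<And>c d. c \<in> D \<Longrightarrow> d \<in> D \<Longrightarrow> c + d \<in> D" "\<And>c. c \<in> D \<Longrightarrow> - c \<in> D"
  shows "{g \<in> \<Gamma>. \<exists>c\<in>D. g = (1, 0, 0, c)} \<lhd> hall_group\<lparr>carrier := \<Gamma>\<rparr>" (is "?N \<lhd> ?G")
proof -
  interpret hall: group "hall_group :: ('k \<times> 'k \<times> 'k \<times> 'k) monoid" by (rule group_hall)
  have G: "group ?G" using subgroup.subgroup_is_group[OF \<Gamma> group_hall] .
  have inv: "inv\<^bsub>?G\<^esub> g = inv\<^bsub>hall_group\<^esub> g" if "g \<in> \<Gamma>" for g
    using group.m_inv_consistent[OF group_hall \<Gamma> that] .
  have "subgroup ?N ?G"
  proof (rule group.subgroupI[OF G])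
    show "?N \<subseteq> carrier ?G" by auto
    show "?N \<noteq> {}" using subgroup.one_closed[OF \<Gamma>] D(1) by auto
    show "inv\<^bsub>?G\<^esub> g \<in> ?N" if "g \<in> ?N" for g
      using that inv[of g] subgroup.m_inv_closed[OF \<Gamma>, of g] D(3) by (auto simp: hall_inv)
    show "g \<otimes>\<^bsub>?G\<^esub> h \<in> ?N" if "g \<in> ?N" "h \<in> ?N" for g h
      using that subgroup.m_closed[OF \<Gamma>, of g h] D(2) by auto
  qed
  moreover have "g \<otimes>\<^bsub>?G\<^esub> h \<otimes>\<^bsub>?G\<^esub> inv\<^bsub>?G\<^esub> g \<in> ?N" if g: "g \<in> carrier ?G" and h: "h \<in> ?N" for g h
  proof -
    have g': "g \<in> \<Gamma>" "g \<in> carrier hall_group" using g subgroup.subset[OF \<Gamma>] by auto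
    have "g \<otimes>\<^bsub>hall_group\<^esub> h = h \<otimes>\<^bsub>hall_group\<^esub> g"
      using h by (cases g) (auto simp: algebra_simps)
    moreover have "h \<in> carrier hall_group" using h subgroup.subset[OF \<Gamma>] by auto
    ultimately have "g \<otimes>\<^bsub>hall_group\<^esub> h \<otimes>\<^bsub>hall_group\<^esub> inv\<^bsub>hall_group\<^esub> g = h"
      using g'(2) by (simp add: hall.m_assoc hall.r_inv hall.r_one del: hall_one)
    then show ?thesis using h inv[OF g'(1)] by simp
  qed
  ultimately show ?thesis unfolding group.normal_inv_iff[OF G] by (intro conjI ballI)
qed

text \<open>Exponent \<open>k\<close> carries the rational label \<open>from_nat (nat k)\<close>, and every rational number is a label.
  So the exponents with label below \<open>r\<close> increase strictly with the real number \<open>r\<close>. Negative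
  exponents share the label of exponent 0.\<close>

definition rational_cut :: "real \<Rightarrow> rat fls set" where
  "rational_cut r = {c. \<forall>k. fls_nth c k \<noteq> 0 \<longrightarrow> of_rat (from_nat (nat k)) < r}"

lemma real_chain_in_hall_group:
  fixes \<Gamma> :: "(rat fls \<times> rat fls \<times> rat fls \<times> rat fls) set"
  defines "\<Gamma> \<equiv> generate hall_group (hall_generators fls_X)"
  shows "\<exists>N :: real \<Rightarrow> _. strict_mono N \<and> (\<forall>r. N r \<lhd> hall_group\<lparr>carrier := \<Gamma>\<rparr>)"
proof -
  define N where "N r = {g \<in> \<Gamma>. \<exists>c\<in>rational_cut r. g = (1, 0, 0, c)}" for r
  have \<Gamma>: "subgroup \<Gamma> hall_group"
    unfolding \<Gamma>_def by (rule group.generate_is_subgroup[OF group_hall]) (auto simp: hall_generators_def)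
  have "N r \<lhd> hall_group\<lparr>carrier := \<Gamma>\<rparr>" for r
    unfolding N_def
  proof (rule central_subgroup_normal[OF \<Gamma>])
    show "c + d \<in> rational_cut r" if "c \<in> rational_cut r" "d \<in> rational_cut r" for c d
      unfolding rational_cut_def
    proof (intro CollectI allI impI)
      fix k assume "fls_nth (c + d) k \<noteq> 0"
      then have "fls_nth c k \<noteq> 0 \<or> fls_nth d k \<noteq> 0" by auto
      then show "of_rat (from_nat (nat k)) < r" using that unfolding rational_cut_def by blast
    qed
  qed (auto simp: rational_cut_def)
  moreover have "strict_mono N"
  proof (rule strict_monoI)
    fix r s :: real assume rs: "r < s"
    obtain q where q: "r < of_rat q" "of_rat q < s" using of_rat_dense[OF rs] by blast
    \<comment> \<open>The power of \<open>x\<close> whose exponent is labelled by \<open>q\<close> lies in the larger subgroup only.\<close>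
    let ?g = "(1, 0, 0, fls_X ^ to_nat q) :: rat fls \<times> rat fls \<times> rat fls \<times> rat fls"
    have "?g \<in> \<Gamma>" unfolding \<Gamma>_def by (rule central_powers_generated) simp
    then have "?g \<in> N s" using q by (auto simp: N_def rational_cut_def)
    moreover have "?g \<notin> N r" using q by (auto simp: N_def rational_cut_def)
    moreover have "rational_cut r \<subseteq> rational_cut s"
      using less_trans[OF _ rs] unfolding rational_cut_def by blast
    then have "N r \<subseteq> N s" unfolding N_def by blast
    ultimately show "N r < N s" by blast
  qed
  ultimately show ?thesis by (intro exI[of _ N]) simp
qed

lemma finitely_generated_generate:
  assumes G: "group G" and X: "finite X" "X \<subseteq> carrier G"
  shows "finitely_generated_group (G\<lparr>carrier := generate G X\<rparr>)"
proof -
  have sub: "subgroup (generate G X) G" using group.generate_is_subgroup[OF G X(2)] .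
  have incl: "X \<subseteq> generate G X" by (auto intro: generate.incl)
  show ?thesis
    unfolding finitely_generated_group_def
    using subgroup.subgroup_is_group[OF sub G] X(1) incl
      group.generate_consistent[OF G incl sub] by auto
qed

section \<open>Continuum many groups\<close>

theorem theoremF:
  shows "iso_classes {G :: nat monoid. finitely_generated_group G \<and> \<not> epiRE G}
    \<approx> (UNIV :: real set)" (is "iso_classes ?\<G> \<approx> _")
proof (rule lepoll_antisym)
  have "iso_classes ?\<G> \<lesssim> ?\<G>"
    unfolding iso_classes_def quotient_def
    by (rule subset_image_lepoll[of _ "\<lambda>H. {(H, K). H \<in> ?\<G> \<and> K \<in> ?\<G> \<and> H \<cong> K} `` {H}"]) blast
  also have "?\<G> \<lesssim> (UNIV :: nat monoid set)" by (rule subset_imp_lepoll) simp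
  also have "(UNIV :: nat monoid set) \<lesssim> (UNIV :: real set)" by (rule nat_monoids_lepoll_reals)
  finally show "iso_classes ?\<G> \<lesssim> (UNIV :: real set)" .
next
  let ?\<Gamma> = "generate hall_group (hall_generators (fls_X :: rat fls))"
  obtain N :: "real \<Rightarrow> _" where N: "strict_mono N" "\<And>r. N r \<lhd> hall_group\<lparr>carrier := ?\<Gamma>\<rparr>"
    using real_chain_in_hall_group by blast
  have "finitely_generated_group (hall_group\<lparr>carrier := ?\<Gamma>\<rparr>)"
    by (rule finitely_generated_generate[OF group_hall]) (auto simp: hall_generators_def)
  then show "(UNIV :: real set) \<lesssim> iso_classes ?\<G>"
    using uncountable_UNIV_real N(2) N(1) by (rule lepoll_non_epiRE_if_normal_chain)
qed

end
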